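(* Let $q=2$, let $d\ge 1$ be an integer and let $j$ be an integer with $(d+1)/2 \le j \le d$. Then: (i) $K_j(1) \le K_j(i)$ for all integers $i$ with $0 \le i \le d-1$. (ii) $K_j(1) \le K_j(d)$ if and only if $j$ is even or $j = d$.
   Context: For $q=2$, $d \ge 1$ and $0\le i,j\le d$, $$K_j(i) = \sum_{h=0}^j (-1)^h \binom{i}{h} \binom{d-i}{j-h}.$$ These are the eigenvalues of the graph $H(d,2,j)$ on the binary vectors of length $d$, two vectors being adjacent when they differ in exactly $j$ coordinates. *)

theory Defs
  imports Complex_Main
begin

text \<open>
  The binary case (alphabet size 2) of the Krawtchouk polynomials: the eigenvalues of the graph
  on the binary vectors of length \<open>d\<close> in which two vectors are adjacent when they differ in exactly
  \<open>j\<close> coordinates. Meaningful for \<open>i \<le> d\<close> and \<open>j \<le> d\<close>; for \<open>i > d\<close> the subtraction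
  \<open>d - i\<close> truncates.
\<close>

definition krawtchouk :: "nat \<Rightarrow> nat \<Rightarrow> nat \<Rightarrow> int" where
  "krawtchouk d j i =
     (\<Sum>h = 0..j. (- 1) ^ h * int (i choose h) * int ((d - i) choose (j - h)))"

end

theory Submission
  imports Defs "HOL-Computational_Algebra.Polynomial"
begin

text \<open>
  Put \<open>F(i, j) = K_j(i) / (d choose j)\<close>. Then \<open>F\<close> is symmetric in \<open>i\<close> and \<open>j\<close>, replacing \<open>i\<close> by
  \<open>d - i\<close> only changes its sign by \<open>(-1)^j\<close>, and
  \<open>(d - j) F(i, j + 1) = (d - 2 i) F(i, j) - j F(i, j - 1)\<close>. For \<open>2 i < d\<close> the recurrence yields
  \<open>\<bar>F(i, j)\<bar> \<le> (d - 2 i) / d = F(i, 1)\<close> by induction on \<open>j\<close> as long as \<open>1 \<le> j \<le> i + 1\<close>. By the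
  symmetries it suffices to prove \<open>\<bar>F(i, j)\<bar> \<le> (d - 2 j) / d\<close> for \<open>1 \<le> i\<close>, \<open>2 i \<le> d\<close> and
  \<open>2 j < d\<close>. If \<open>i \<le> j + 1\<close>, this is the bound for \<open>F(j, i)\<close>; otherwise \<open>j < i\<close>, and the bound
  \<open>(d - 2 i) / d\<close> for \<open>F(i, j)\<close> is even smaller. In the middle case \<open>2 i = d\<close>, where \<open>F(i, 1) = 0\<close>,
  the same induction gives the bound \<open>2 / d\<close>, which suffices because \<open>d - 2 j\<close> is then even and positive.
\<close>

section \<open>Generating polynomial and three-term recurrence\<close>

definition krawtchouk_poly :: "nat \<Rightarrow> nat \<Rightarrow> int poly" where
  "krawtchouk_poly d i = [:1, -1:] ^ i * [:1, 1:] ^ (d - i)"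

lemma coeff_one_linear_power:
  fixes b :: "'a :: comm_semiring_1"
  shows "coeff ([:1, b:] ^ n) k = of_nat (n choose k) * b ^ k"
proof (cases "k \<le> n")
  case True
  then show ?thesis by (simp add: coeff_linear_poly_power)
next
  case False
  have "degree ([:1, b:] ^ n) \<le> degree [:1, b:] * n"
    by (rule degree_power_le)
  also have "\<dots> \<le> n"
    by (cases "b = 0") simp_all
  finally show ?thesis
    using False by (simp add: coeff_eq_0 binomial_eq_0)
qed

lemma coeff_krawtchouk_poly: "coeff (krawtchouk_poly d i) j = krawtchouk d j i"
  by (simp add: krawtchouk_poly_def krawtchouk_def coeff_mult coeff_one_linear_power
      atLeast0AtMost mult_ac)

lemma pderiv_linear_power:
  fixes a b :: "'a :: {comm_ring_1, ring_no_zero_divisors, ring_char_0}"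
  shows "[:a, b:] * pderiv ([:a, b:] ^ n) = smult (of_nat n * b) ([:a, b:] ^ n)"
proof (cases n)
  case (Suc m)
  have "pderiv ([:a, b:] ^ n) = smult (of_nat n * b) ([:a, b:] ^ m)"
    unfolding Suc pderiv_power_Suc by (simp add: pderiv_pCons mult.commute)
  then show ?thesis by (simp only: Suc power_Suc mult_smult_right)
qed simp

text \<open>Logarithmic derivative \<open>P'/P = -i/(1 - x) + (d - i)/(1 + x)\<close> of the
  generating polynomial, cleared of denominators by \<open>1 - x^2\<close>.\<close>

lemma pderiv_krawtchouk_poly:
  assumes "i \<le> d"
  shows "[:1, 0, -1:] * pderiv (krawtchouk_poly d i)
       = [:int d - 2 * int i, - int d:] * krawtchouk_poly d i"
proof -
  define A B where "A = [:1, -1 :: int:] ^ i" and "B = [:1, 1 :: int:] ^ (d - i)"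
  have A: "[:1, -1:] * pderiv A = [:- int i:] * A"
    using pderiv_linear_power[of 1 "-1 :: int" i] by (simp add: A_def)
  have B: "[:1, 1:] * pderiv B = [:int d - int i:] * B"
    using pderiv_linear_power[of 1 "1 :: int" "d - i"] assms by (simp add: B_def of_nat_diff)
  have "[:1, 0, -1:] * pderiv (A * B)
      = [:1, 1:] * ([:1, -1:] * pderiv A) * B + [:1, -1:] * ([:1, 1:] * pderiv B) * A"
  proof -
    have "[:1, 0, -1 :: int:] = [:1, 1:] * [:1, -1:]" by simp
    then show ?thesis by (simp only: pderiv_mult) (simp only: algebra_simps)
  qed
  also have "\<dots> = ([:1, 1:] * [:- int i:] + [:1, -1:] * [:int d - int i:]) * (A * B)"
    unfolding A B by (simp only: algebra_simps)
  also have "[:1, 1:] * [:- int i:] + [:1, -1:] * [:int d - int i:] = [:int d - 2 * int i, - int d:]"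
    by simp
  finally show ?thesis by (simp add: krawtchouk_poly_def A_def B_def)
qed

lemma krawtchouk_recurrence:
  assumes "i \<le> d"
  shows "(int j + 2) * krawtchouk d (j + 2) i
       = (int d - 2 * int i) * krawtchouk d (j + 1) i - (int d - int j) * krawtchouk d j i"
proof -
  \<comment> \<open>Coefficients of \<open>x^(j+1)\<close> are compared. The part
    \<open>x^2 P'\<close> contributes the coefficient of \<open>P'\<close> at \<open>j - 1\<close>,
    which is absent for \<open>j = 0\<close>; there the factor \<open>int j\<close> vanishes
    too.\<close>
  have "coeff ([:1, 0, -1:] * pderiv (krawtchouk_poly d i)) (Suc j)
      = (int j + 2) * krawtchouk d (j + 2) i - int j * krawtchouk d j i"
    by (cases j) (simp_all add: coeff_pCons coeff_pderiv coeff_krawtchouk_poly)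
  moreover have "coeff ([:int d - 2 * int i, - int d:] * krawtchouk_poly d i) (Suc j)
      = (int d - 2 * int i) * krawtchouk d (j + 1) i - int d * krawtchouk d j i"
    by (simp add: coeff_krawtchouk_poly)
  ultimately show ?thesis
    unfolding pderiv_krawtchouk_poly[OF assms] by (simp add: algebra_simps)
qed

lemma krawtchouk_0 [simp]: "krawtchouk d 0 i = 1"
  by (simp add: krawtchouk_def)

lemma krawtchouk_1: "i \<le> d \<Longrightarrow> krawtchouk d 1 i = int d - 2 * int i"
  by (simp add: krawtchouk_def of_nat_diff)

section \<open>Reflection and duality\<close>

lemma krawtchouk_reflect:
  assumes "i \<le> d"
  shows "krawtchouk d j (d - i) = (- 1) ^ j * krawtchouk d j i"
proof -
  have "krawtchouk d j (d - i)
      = (\<Sum>h = 0..j. (- 1) ^ (j - h) * int ((d - i) choose (j - h)) * int (i choose h))"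
    unfolding krawtchouk_def using assms
    by (intro sum.reindex_bij_witness[of _ "\<lambda>h. j - h" "\<lambda>h. j - h"]) auto
  also have "\<dots> = (\<Sum>h = 0..j. (- 1) ^ j * ((- 1) ^ h * int (i choose h) * int ((d - i) choose (j - h))))"
    by (intro sum.cong refl) (simp add: minus_one_power_iff)
  finally show ?thesis by (simp add: krawtchouk_def sum_distrib_left)
qed

text \<open>Both sides count pairs of disjoint subsets of sizes \<open>a\<close> and
  \<open>b\<close> in an \<open>n\<close>-set.\<close>

lemma choose_mult_choose_commute:
  "(n choose a) * ((n - a) choose b) = (n choose b) * ((n - b) choose a)"
proof (cases "a + b \<le> n")
  case True
  then show ?thesis
    using choose_mult[of a "a + b" n] choose_mult[of b "a + b" n]
    by (simp add: binomial_symmetric[of a "a + b"])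
next
  case False
  then have "n < a \<or> n - a < b" and "n < b \<or> n - b < a" by auto
  then show ?thesis by (metis binomial_eq_0 mult_zero_left mult_zero_right)
qed

text \<open>Up to sign, the term for \<open>h\<close> counts pairs of sets of sizes \<open>i\<close>
  and \<open>j\<close> that meet in \<open>h\<close> points, which is symmetric in \<open>i\<close>
  and \<open>j\<close>.\<close>

lemma krawtchouk_swap:
  assumes "i \<le> d" "j \<le> d"
  shows "int (d choose i) * krawtchouk d j i = int (d choose j) * krawtchouk d i j"
proof -
  define t where "t i j h = (- 1 :: int) ^ h * int ((d choose i) * (i choose h) * ((d - i) choose (j - h)))"
    for i j h
  have expand: "int (d choose i) * krawtchouk d j i = (\<Sum>h = 0..min i j. t i j h)" for i j
  proof -
    have "int (d choose i) * krawtchouk d j i = (\<Sum>h = 0..j. t i j h)"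
      by (simp add: krawtchouk_def t_def sum_distrib_left mult_ac)
    also have "\<dots> = (\<Sum>h = 0..min i j. t i j h)"
      by (intro sum.mono_neutral_right) (auto simp: t_def binomial_eq_0)
    finally show ?thesis .
  qed
  have "t i j h = t j i h" if "h \<le> i" "h \<le> j" for h
  proof -
    \<comment> \<open>The intersection is chosen first, then the two disjoint remainders, whose
      order is immaterial.\<close>
    have "(d choose i) * (i choose h) * ((d - i) choose (j - h))
        = (d choose h) * (((d - h) choose (i - h)) * ((d - h - (i - h)) choose (j - h)))"
      using choose_mult[of h i d] that assms by (simp add: mult.assoc)
    also have "\<dots> = (d choose h) * (((d - h) choose (j - h)) * ((d - h - (j - h)) choose (i - h)))"
      by (simp only: choose_mult_choose_commute)
    also have "\<dots> = (d choose j) * (j choose h) * ((d - j) choose (i - h))"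
      using choose_mult[of h j d] that assms by (simp add: mult.assoc)
    finally show ?thesis by (simp add: t_def)
  qed
  then show ?thesis
    unfolding expand by (simp add: min.commute)
qed

section \<open>Normalized values\<close>

definition krawtchouk_normalized :: "nat \<Rightarrow> nat \<Rightarrow> nat \<Rightarrow> real" where
  "krawtchouk_normalized d i j = real_of_int (krawtchouk d j i) / real (d choose j)"

lemma krawtchouk_normalized_mult:
  "j \<le> d \<Longrightarrow> real_of_int (krawtchouk d j i) = real (d choose j) * krawtchouk_normalized d i j"
  by (simp add: krawtchouk_normalized_def)

lemma krawtchouk_normalized_commute:
  assumes "i \<le> d" "j \<le> d"
  shows "krawtchouk_normalized d i j = krawtchouk_normalized d j i"
proof -
  have "real (d choose i) * real_of_int (krawtchouk d j i) = real (d choose j) * real_of_int (krawtchouk d i j)"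
    using arg_cong[OF krawtchouk_swap[OF assms], of real_of_int] by simp
  then show ?thesis using assms
    by (simp add: krawtchouk_normalized_def field_simps)
qed

lemma krawtchouk_normalized_0: "krawtchouk_normalized d i 0 = 1"
  by (simp add: krawtchouk_normalized_def)

lemma krawtchouk_normalized_1:
  "i \<le> d \<Longrightarrow> krawtchouk_normalized d i 1 = (real d - 2 * real i) / real d"
  by (simp add: krawtchouk_normalized_def krawtchouk_1[simplified])

lemma krawtchouk_normalized_reflect:
  "i \<le> d \<Longrightarrow> krawtchouk_normalized d (d - i) j = (- 1) ^ j * krawtchouk_normalized d i j"
  by (simp add: krawtchouk_normalized_def krawtchouk_reflect)

lemma krawtchouk_normalized_recurrence:
  assumes "i \<le> d" "j + 2 \<le> d"
  shows "(real d - real j - 1) * krawtchouk_normalized d i (j + 2)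
       = (real d - 2 * real i) * krawtchouk_normalized d i (j + 1)
         - (real j + 1) * krawtchouk_normalized d i j"
proof -
  define F where "F = krawtchouk_normalized d i"
  define C where "C = (\<lambda>k. real (d choose k))"
  have absorb: "(real k + 1) * C (k + 1) = (real d - real k) * C k" if "k \<le> d" for k
  proof -
    have "Suc k * (d choose Suc k) = (d - k) * (d choose k)"
      by (simp only: binomial_absorption binomial_absorb_comp)
    then have "real (Suc k * (d choose Suc k)) = real ((d - k) * (d choose k))"
      by simp
    then show ?thesis
      using that by (simp add: C_def of_nat_diff algebra_simps)
  qed
  have "(real j + 2) * real_of_int (krawtchouk d (j + 2) i)
      = (real d - 2 * real i) * real_of_int (krawtchouk d (j + 1) i)
        - (real d - real j) * real_of_int (krawtchouk d j i)"
    using arg_cong[OF krawtchouk_recurrence[OF assms(1), of j], of real_of_int] by simp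
  then have scaled: "((real j + 2) * C (j + 2)) * F (j + 2)
      = (real d - 2 * real i) * (C (j + 1) * F (j + 1)) - ((real d - real j) * C j) * F j"
    using assms(2) by (simp add: krawtchouk_normalized_mult F_def C_def)
  \<comment> \<open>Both outer binomials become multiples of the middle one, which then
    cancels.\<close>
  have up: "(real j + 2) * C (j + 2) = (real d - real j - 1) * C (j + 1)"
    using absorb[of "j + 1"] assms(2) by (simp add: algebra_simps)
  have down: "(real d - real j) * C j = (real j + 1) * C (j + 1)"
    using absorb[of j] assms(2) by simp
  have "C (j + 1) * ((real d - real j - 1) * F (j + 2))
      = C (j + 1) * ((real d - 2 * real i) * F (j + 1) - (real j + 1) * F j)"
    using scaled unfolding up down by (simp add: algebra_simps)
  moreover have "C (j + 1) \<noteq> 0"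
    using assms(2) by (simp add: C_def)
  ultimately show ?thesis
    by (simp add: F_def)
qed

section \<open>Bounds on the normalized values\<close>

text \<open>A separate base case: the inductive estimate would use the bound at index 0, where the
  value is 1 and the bound may fail.\<close>

lemma abs_krawtchouk_normalized_2_le:
  assumes "2 * i \<le> d" "2 \<le> d"
  shows "\<bar>krawtchouk_normalized d i 2\<bar> \<le> real (if 2 * i = d then 2 else d - 2 * i) / real d"
proof -
  define x where "x = d - 2 * i"
  have x: "real x = real d - 2 * real i" "x \<le> d"
    using assms by (auto simp: x_def of_nat_diff)
  have "(real d - 1) * krawtchouk_normalized d i 2 = real x * (real x / real d) - 1"
    using krawtchouk_normalized_recurrence[of i d 0] assms
    by (simp add: krawtchouk_normalized_0 krawtchouk_normalized_1[simplified] x(1) numeral_2_eq_2)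
  then have F2: "krawtchouk_normalized d i 2 = ((real x)\<^sup>2 - real d) / (real d * (real d - 1))"
    using assms by (simp add: field_simps power2_eq_square)
  show ?thesis
  proof (cases "x = 0")
    case True
    then show ?thesis using assms
      by (simp add: F2 x_def field_simps)
  next
    case False
    \<comment> \<open>These products equal \<open>x (d - 1) + (x^2 - d)\<close> and
      \<open>x (d - 1) - (x^2 - d)\<close>.\<close>
    have "(real x - 1) * (real x + real d) \<ge> 0" "(real d - real x) * (real x + 1) \<ge> 0"
      using False x(2) by simp_all
    then have le: "\<bar>(real x)\<^sup>2 - real d\<bar> \<le> real x * (real d - 1)"
      unfolding abs_le_iff by (auto simp: algebra_simps power2_eq_square)
    have "\<bar>krawtchouk_normalized d i 2\<bar> \<le> real x / real d"
    proof -
      have "\<bar>krawtchouk_normalized d i 2\<bar> = \<bar>(real x)\<^sup>2 - real d\<bar> / (real d * (real d - 1))"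
        using assms(2) by (simp add: F2 abs_mult)
      also have "\<dots> \<le> real x * (real d - 1) / (real d * (real d - 1))"
        using assms(2) le by (intro divide_right_mono) auto
      finally show ?thesis using assms(2) by simp
    qed
    then show ?thesis using False by (simp add: x_def)
  qed
qed

lemma abs_krawtchouk_normalized_le:
  assumes "2 * i \<le> d" "1 \<le> j" "j \<le> i + 1" "j \<le> d"
  shows "\<bar>krawtchouk_normalized d i j\<bar> \<le> real (if 2 * i = d then 2 else d - 2 * i) / real d"
    (is "_ \<le> ?c / _")
  using assms(2-)
proof (induction j rule: less_induct)
  case (less j)
  consider "j = 1" | "j = 2" | k where "j = k + 2" "k \<ge> 1"
    using less.prems(1) that(3)[of "j - 2"] by linarith
  then show ?case
  proof cases
    case 1
    then show ?thesis using assms(1)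
      by (auto simp: krawtchouk_normalized_1[simplified] of_nat_diff)
  next
    case 2
    then show ?thesis using abs_krawtchouk_normalized_2_le assms(1) less.prems by simp
  next
    case (3 k)
    define F where "F = krawtchouk_normalized d i"
    have IH: "\<bar>F (k + 1)\<bar> \<le> ?c / real d" "\<bar>F k\<bar> \<le> ?c / real d"
      using less.IH[of "k + 1"] less.IH[of k] less.prems 3 by (auto simp: F_def)
    have pos: "real d - real k - 1 > 0"
      using less.prems 3 by simp
    have "(real d - real k - 1) * \<bar>F j\<bar> = \<bar>(real d - real k - 1) * F j\<bar>"
      using pos by (simp add: abs_mult)
    also have "\<dots> = \<bar>(real d - 2 * real i) * F (k + 1) - (real k + 1) * F k\<bar>"
      using krawtchouk_normalized_recurrence[of i d k] assms(1) less.prems 3 by (simp add: F_def)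
    also have "\<dots> \<le> (real d - 2 * real i) * \<bar>F (k + 1)\<bar> + (real k + 1) * \<bar>F k\<bar>"
      using assms(1) abs_triangle_ineq4[of "(real d - 2 * real i) * F (k + 1)" "(real k + 1) * F k"]
      by (simp add: abs_mult)
    also have "\<dots> \<le> (real d - 2 * real i) * (?c / real d) + (real k + 1) * (?c / real d)"
      using assms(1) by (intro add_mono mult_left_mono IH) auto
    also have "\<dots> = (real d - 2 * real i + real k + 1) * (?c / real d)"
      by (simp only: algebra_simps)
    \<comment> \<open>This amounts to \<open>k + 1 \<le> i\<close>, which is exactly
      \<open>j \<le> i + 1\<close>.\<close>
    also have "\<dots> \<le> (real d - real k - 1) * (?c / real d)"
      using less.prems 3 by (intro mult_right_mono) auto
    finally show ?thesis
      using pos by (simp only: mult_le_cancel_left_pos F_def)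
  qed
qed

lemma abs_krawtchouk_normalized_le_half:
  assumes "1 \<le> i" "2 * i \<le> d" "2 * j < d"
  shows "\<bar>krawtchouk_normalized d i j\<bar> \<le> (real d - 2 * real j) / real d"
proof -
  consider "j = 0" | "i \<le> j + 1" | "1 \<le> j" "j + 1 < i" by linarith
  then show ?thesis
  proof cases
    case 1
    then show ?thesis using assms by (simp add: krawtchouk_normalized_0)
  next
    case 2
    then show ?thesis
      using abs_krawtchouk_normalized_le[of j d i] krawtchouk_normalized_commute[of i d j] assms
      by (simp add: of_nat_diff split: if_splits)
  next
    case 3
    have "\<bar>krawtchouk_normalized d i j\<bar> \<le> real (if 2 * i = d then 2 else d - 2 * i) / real d"
      using 3 assms by (intro abs_krawtchouk_normalized_le) auto
    \<comment> \<open>From \<open>j + 2 \<le> i\<close> and \<open>2 * i \<le> d\<close>, the number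
      \<open>d - 2 * j\<close> is at least 4 and exceeds \<open>d - 2 * i\<close>, so both branches
      are covered.\<close>
    also have "\<dots> \<le> real (d - 2 * j) / real d"
      using 3 assms by (intro divide_right_mono of_nat_mono) auto
    finally show ?thesis using assms by (simp add: of_nat_diff)
  qed
qed

lemma abs_krawtchouk_normalized_reflect:
  "i \<le> d \<Longrightarrow> \<bar>krawtchouk_normalized d (d - i) j\<bar> = \<bar>krawtchouk_normalized d i j\<bar>"
  by (simp add: krawtchouk_normalized_reflect abs_mult)

lemma abs_krawtchouk_normalized_le_first:
  assumes "1 \<le> i" "i < d" "d < 2 * j" "j \<le> d"
  shows "\<bar>krawtchouk_normalized d i j\<bar> \<le> (2 * real j - real d) / real d"
proof -
  \<comment> \<open>Both arguments are folded into the lower half; absolute values absorb the signs.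
    Reflecting \<open>j\<close> goes through the symmetry in the two arguments.\<close>
  define i' where "i' = (if 2 * i \<le> d then i else d - i)"
  have i': "1 \<le> i'" "2 * i' \<le> d" "i' \<le> d"
    using assms by (auto simp: i'_def)
  have "\<bar>krawtchouk_normalized d i j\<bar> = \<bar>krawtchouk_normalized d i' j\<bar>"
    using assms by (simp add: i'_def abs_krawtchouk_normalized_reflect)
  also have "\<dots> = \<bar>krawtchouk_normalized d i' (d - j)\<bar>"
    using i' assms by (simp add: krawtchouk_normalized_commute[of i'] abs_krawtchouk_normalized_reflect)
  also have "\<dots> \<le> (real d - 2 * real (d - j)) / real d"
    using i' assms by (intro abs_krawtchouk_normalized_le_half) auto
  finally show ?thesis using assms by (simp add: of_nat_diff algebra_simps)
qed

theorem corollary1p3: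
  fixes d j :: nat
  assumes "d \<ge> 1"
    and "(real d + 1) / 2 \<le> real j"
    and "j \<le> d"
  shows "(\<forall>i. i \<le> d - 1 \<longrightarrow> krawtchouk d j 1 \<le> krawtchouk d j i) \<and>
         (krawtchouk d j 1 \<le> krawtchouk d j d \<longleftrightarrow> even j \<or> j = d)"
proof -
  define F where "F = krawtchouk_normalized d"
  have dj: "d < 2 * j"
    using assms(2) by (simp add: field_simps)
  have F0: "F 0 j = 1"
    using krawtchouk_normalized_commute[of 0 d j] assms(3) by (simp add: F_def krawtchouk_normalized_0)
  \<comment> \<open>This is minus the bound of \<open>abs_krawtchouk_normalized_le_first\<close>, so
    \<open>i = 1\<close> attains the least value that bound permits.\<close>
  have F1: "F 1 j = - ((2 * real j - real d) / real d)"
    using krawtchouk_normalized_commute[of 1 d j] krawtchouk_normalized_1[of j d] assms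
    by (simp add: F_def field_simps)
  have Fd: "F d j = (- 1) ^ j"
    using krawtchouk_normalized_reflect[of 0 d j] F0 by (simp add: F_def)
  have le_iff: "krawtchouk d j 1 \<le> krawtchouk d j i \<longleftrightarrow> F 1 j \<le> F i j" for i
  proof -
    have "krawtchouk d j 1 \<le> krawtchouk d j i
        \<longleftrightarrow> real_of_int (krawtchouk d j 1) \<le> real_of_int (krawtchouk d j i)"
      by (rule of_int_le_iff[symmetric])
    also have "\<dots> \<longleftrightarrow> F 1 j \<le> F i j"
      using assms(3) by (simp only: krawtchouk_normalized_mult F_def) simp
    finally show ?thesis .
  qed
  have "F 1 j \<le> F i j" if "i \<le> d - 1" for i
  proof (cases "i = 0")
    case True
    have "F 1 j \<le> 0" using dj unfolding F1 by simp
    then show ?thesis using True F0 by simp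
  next
    case False
    then have "\<bar>F i j\<bar> \<le> (2 * real j - real d) / real d"
      using abs_krawtchouk_normalized_le_first[of i d j] that dj assms by (simp add: F_def)
    then show ?thesis unfolding F1 by linarith
  qed
  \<comment> \<open>For even \<open>j\<close> the right side is 1 and the left negative. For odd
    \<open>j\<close> the right side is -1, and the inequality says \<open>2 j - d \<ge> d\<close>,
    which forces \<open>j = d\<close>.\<close>
  moreover have "F 1 j \<le> F d j \<longleftrightarrow> even j \<or> j = d"
    unfolding F1 Fd using assms dj by (cases "even j") (auto simp: field_simps)
  ultimately show ?thesis unfolding le_iff by blast
qed

end
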